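(* Let $(A,\mu,\alpha)$ be a left Hom-alternative algebra over $\mathbf{K}$. Then: (a) $(A,\mu_k,\alpha_{k'})$ is a left Hom-alternative algebra for all $k,k'\in\mathbf{K}$, where $\mu_k=k\mu$ and $\alpha_{k'}=k'\alpha$; (b) $(A,\mu^{op},\alpha)$ is a right Hom-alternative algebra, where $\mu^{op}(x,y)=\mu(y,x)$ for all $x,y\in A$.
   Context: $\mathbf{K}$ is a field of characteristic $0$; linearity and $\otimes$ are over $\mathbf{K}$. A left (resp. right) Hom-alternative algebra is a triple $(A,\mu,\alpha)$ where $A$ is a $\mathbf{K}$-linear space, $\mu:A\otimes A\to A$ and $\alpha:A\to A$ are linear maps, and for all $x,y\in A$, $\mu(\alpha(x),\mu(x,y))=\mu(\mu(x,x),\alpha(y))$ (resp. $\mu(\alpha(x),\mu(y,y))=\mu(\mu(x,y),\alpha(y))$). *)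

theory Defs
  imports Complex_Main
begin

text \<open>
  The linear space is the whole type \<open>'a\<close> with scalar multiplication \<open>scale\<close>. A linear map
  from the tensor square to the space is given by the corresponding bilinear map
  \<open>\<mu>\<close>, required to be linear in each argument.
\<close>

locale hom_algebra = vector_space scale
  for scale :: "'k::field_char_0 \<Rightarrow> 'a::ab_group_add \<Rightarrow> 'a" +
  fixes \<mu> :: "'a \<Rightarrow> 'a \<Rightarrow> 'a"
    and \<alpha> :: "'a \<Rightarrow> 'a"
  assumes linear_mult_left: "\<And>y. Vector_Spaces.linear scale scale (\<lambda>x. \<mu> x y)"
    and linear_mult_right: "\<And>x. Vector_Spaces.linear scale scale (\<lambda>y. \<mu> x y)"
    and linear_twist: "Vector_Spaces.linear scale scale \<alpha>"

locale left_hom_alternative = hom_algebra scale \<mu> \<alpha>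
  for scale :: "'k::field_char_0 \<Rightarrow> 'a::ab_group_add \<Rightarrow> 'a"
    and \<mu> :: "'a \<Rightarrow> 'a \<Rightarrow> 'a"
    and \<alpha> :: "'a \<Rightarrow> 'a" +
  assumes left_alternative: "\<And>x y. \<mu> (\<alpha> x) (\<mu> x y) = \<mu> (\<mu> x x) (\<alpha> y)"

locale right_hom_alternative = hom_algebra scale \<mu> \<alpha>
  for scale :: "'k::field_char_0 \<Rightarrow> 'a::ab_group_add \<Rightarrow> 'a"
    and \<mu> :: "'a \<Rightarrow> 'a \<Rightarrow> 'a"
    and \<alpha> :: "'a \<Rightarrow> 'a" +
  assumes right_alternative: "\<And>x y. \<mu> (\<alpha> x) (\<mu> y y) = \<mu> (\<mu> x y) (\<alpha> y)"

end

theory Submission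
  imports Defs
begin

text \<open>Both parts are read off from the defining identity. Each side of it contains \<mu> twice
  and \<alpha> once, so replacing \<mu> by k\<mu> and \<alpha> by k'\<alpha> multiplies both sides
  by the same scalar k^2 k'; \<open>mult_scale_left\<close> and \<open>mult_scale_right\<close> let
  the inner factors come out. Reversing the arguments of \<mu> turns the left identity into the
  right one with the two variables exchanged.\<close>

context left_hom_alternative
begin

text \<open>Taking the space as both source and target gives access to \<open>linear_scale\<close>
  and \<open>linear_compose_scale_right\<close> for its endomorphisms.\<close>

sublocale vector_space_pair scale scale ..

lemma mult_scale_left: "\<mu> (scale c x) y = scale c (\<mu> x y)"
  using linear_mult_left by (rule linear_scale)

lemma mult_scale_right: "\<mu> x (scale c y) = scale c (\<mu> x y)"
  using linear_mult_right by (rule linear_scale)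

lemma left_hom_alternative_scaled:
  "left_hom_alternative scale (\<lambda>x y. scale k (\<mu> x y)) (\<lambda>x. scale k' (\<alpha> x))"
proof (intro left_hom_alternative.intro hom_algebra.intro hom_algebra_axioms.intro
    left_hom_alternative_axioms.intro vector_space_axioms)
  fix x y
  show "Vector_Spaces.linear scale scale (\<lambda>x. scale k (\<mu> x y))"
    using linear_mult_left by (rule linear_compose_scale_right)
  show "Vector_Spaces.linear scale scale (\<lambda>y. scale k (\<mu> x y))"
    using linear_mult_right by (rule linear_compose_scale_right)
  show "Vector_Spaces.linear scale scale (\<lambda>x. scale k' (\<alpha> x))"
    using linear_twist by (rule linear_compose_scale_right)
  show "scale k (\<mu> (scale k' (\<alpha> x)) (scale k (\<mu> x y)))
      = scale k (\<mu> (scale k (\<mu> x x)) (scale k' (\<alpha> y)))"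
    \<comment> \<open>Once the scalars are pulled out, the factors are k, k', k on the left and k,
      k, k' on the right; commutativity of the field matches them.\<close>
    by (simp add: mult_scale_left mult_scale_right left_alternative mult.left_commute mult.commute)
qed

lemma right_hom_alternative_opposite: "right_hom_alternative scale (\<lambda>x y. \<mu> y x) \<alpha>"
proof (intro right_hom_alternative.intro hom_algebra.intro hom_algebra_axioms.intro
    right_hom_alternative_axioms.intro vector_space_axioms)
  fix x y
  show "Vector_Spaces.linear scale scale (\<lambda>x. \<mu> y x)"
    by (rule linear_mult_right)
  show "Vector_Spaces.linear scale scale (\<lambda>y. \<mu> y x)"
    by (rule linear_mult_left)
  show "Vector_Spaces.linear scale scale \<alpha>"
    by (rule linear_twist)
  show "\<mu> (\<mu> y y) (\<alpha> x) = \<mu> (\<alpha> y) (\<mu> y x)"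
    \<comment> \<open>This is the left identity at the pair (y, x), read from right to left.\<close>
    by (rule left_alternative [symmetric])
qed

end

theorem lemma2p1:
  fixes scale :: "'k::field_char_0 \<Rightarrow> 'a::ab_group_add \<Rightarrow> 'a"
    and \<mu> :: "'a \<Rightarrow> 'a \<Rightarrow> 'a"
    and \<alpha> :: "'a \<Rightarrow> 'a"
  assumes "left_hom_alternative scale \<mu> \<alpha>"
  shows "(\<forall>k k'. left_hom_alternative scale (\<lambda>x y. scale k (\<mu> x y)) (\<lambda>x. scale k' (\<alpha> x)))
    \<and> right_hom_alternative scale (\<lambda>x y. \<mu> y x) \<alpha>"
  using left_hom_alternative.left_hom_alternative_scaled[OF assms]
    left_hom_alternative.right_hom_alternative_opposite[OF assms]
  by blast

end
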